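(* Let $\mathcal{L}_t$ be the finite set of possible positions of the user at timestep $t$, let $\delta\in(0,1]$, $\epsilon>0$, and let $\mathcal{L}^*_t\subseteq\mathcal{L}_t$ be the $\delta$-obfuscation set used at timestep $t$. If a randomized mechanism $\mathcal{M}$ satisfies $\epsilon$-LDP on $\mathcal{L}^*_t$, then $\mathcal{M}$ satisfies $(\epsilon,\delta)$-location privacy on $\mathcal{L}_t$; that is, for any output $z_t$, any location $l_i\in\mathcal{L}_t$, and any adversary knowing that the true location $l^*_t$ is in $\mathcal{L}^*_t$: \[ Pr^+[l_i=l^*_t\mid l^*_t\in\mathcal{L}^*_t]=0 \quad\text{if } l_i\notin\mathcal{L}^*_t, \] \[ Pr^+[l_i=l^*_t\mid l^*_t\in\mathcal{L}^*_t]\le \delta^{-1}\cdot e^{\epsilon}\cdot Pr^-[l_i=l^*_t]\quad\text{otherwise.} \]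
   Context: Setting. $\mathcal{L}_t$ is the finite set of possible locations of a user at timestep $t$; $l^*_t$ is the (unknown) true location. An adversary is modelled by a prior probability distribution $Pr^-$ on $\mathcal{L}_t$, where $Pr^-[l=l^*_t]$ is the adversary's belief, before the release at timestep $t$, that $l$ is the true location. A mechanism $\mathcal{M}$ is a randomized map that releases an output $z_t$ given the true location, with conditional probability (or density) $Pr[z_t\mid l=l^*_t]$. $\delta$-obfuscation set: a subset $\mathcal{L}^*_t\subseteq\mathcal{L}_t$ with $\sum_{l\in\mathcal{L}^*_t}Pr^-[l=l^*_t]=\delta$. It is assumed that $l^*_t\in\mathcal{L}^*_t$ and that the adversary knows $\mathcal{L}^*_t$ and the fact that $l^*_t\in\mathcal{L}^*_t$. Such an adversary's belief before the release is the conditional prior $Pr^-[l=l^*_t\mid l^*_t\in\mathcal{L}^*_t]$. After observing $z_t$ (of positive probability or density under this belief) it is the Bayesian posterior $Pr^+[l=l^*_t\mid l^*_t\in\mathcal{L}^*_t]$, obtained from this conditional prior and the likelihood $Pr[z_t\mid l=l^*_t]$, i.e. likelihood times conditional prior, normalized over $\mathcal{L}_t$. $\epsilon$-LDP on $\mathcal{L}^*_t$: for any output $z_t$, any $l_i\in\mathcal{L}^*_t$ and any adversary knowing that $l^*_t\in\mathcal{L}^*_t$, the adversary's posterior is at most $e^\epsilon$ times its prior, i.e. $Pr^+[l_i=l^*_t\mid l^*_t\in\mathcal{L}^*_t]\le e^\epsilon\cdot Pr^-[l_i=l^*_t\mid l^*_t\in\mathcal{L}^*_t]$. "Any adversary"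 means any prior $Pr^-$ on $\mathcal{L}_t$ that gives $\mathcal{L}^*_t$ total mass $\delta$. *)

theory Defs
  imports "HOL-Probability.Probability"
begin

text \<open>
  A mechanism on the locations \<open>L\<close> is given by its conditional densities: with true location \<open>l\<close>, the
  output has law \<open>density N (f l)\<close>, and \<open>f l z\<close> is the likelihood of the output \<open>z\<close>. For
  \<open>N = count_space UNIV\<close> the likelihoods are conditional probabilities, for \<open>N = lborel\<close> they are
  ordinary densities.
\<close>
definition mechanism :: "'l set \<Rightarrow> 'z measure \<Rightarrow> ('l \<Rightarrow> 'z \<Rightarrow> real) \<Rightarrow> bool" where
  "mechanism L N f \<longleftrightarrow>
     (\<forall>l\<in>L. f l \<in> borel_measurable N \<and> (\<forall>z\<in>space N. 0 \<le> f l z) \<and>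
            prob_space (density N (\<lambda>z. ennreal (f l z))))"

definition obfuscation_set :: "'l set \<Rightarrow> 'l pmf \<Rightarrow> real \<Rightarrow> 'l set \<Rightarrow> bool" where
  "obfuscation_set L p \<delta> S \<longleftrightarrow> S \<subseteq> L \<and> (\<Sum>l\<in>S. pmf p l) = \<delta>"

text \<open>
  The adversaries who know that the true location lies in \<open>S\<close>, represented by their unconditional
  priors \<open>p\<close> on \<open>L\<close>. The knowledge itself enters by conditioning: the belief of such an adversary
  before the release is \<open>cond_pmf p S\<close>, which is well defined whenever \<open>\<delta> > 0\<close>.
\<close>
definition adversary :: "'l set \<Rightarrow> real \<Rightarrow> 'l set \<Rightarrow> 'l pmf \<Rightarrow> bool" where
  "adversary L \<delta> S p \<longleftrightarrow> set_pmf p \<subseteq> L \<and> obfuscation_set L p \<delta> S"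

definition evidence :: "'l set \<Rightarrow> ('l \<Rightarrow> 'z \<Rightarrow> real) \<Rightarrow> 'l pmf \<Rightarrow> 'z \<Rightarrow> real" where
  "evidence L f q z = (\<Sum>l\<in>L. f l z * pmf q l)"

definition posterior :: "'l set \<Rightarrow> ('l \<Rightarrow> 'z \<Rightarrow> real) \<Rightarrow> 'l pmf \<Rightarrow> 'z \<Rightarrow> 'l \<Rightarrow> real" where
  "posterior L f q z l = f l z * pmf q l / evidence L f q z"

text \<open>
  Outputs of zero evidence under the adversary's belief are excluded below, since Bayes' rule yields
  no posterior for them.
\<close>
definition LDP ::
    "'l set \<Rightarrow> 'z measure \<Rightarrow> ('l \<Rightarrow> 'z \<Rightarrow> real) \<Rightarrow> real \<Rightarrow> real \<Rightarrow> 'l set \<Rightarrow> bool" where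
  "LDP L N f \<epsilon> \<delta> S \<longleftrightarrow>
     (\<forall>p. adversary L \<delta> S p \<longrightarrow>
       (\<forall>z\<in>space N. evidence L f (cond_pmf p S) z > 0 \<longrightarrow>
         (\<forall>l\<in>S. posterior L f (cond_pmf p S) z l \<le> exp \<epsilon> * pmf (cond_pmf p S) l)))"

definition location_privacy ::
    "'l set \<Rightarrow> 'z measure \<Rightarrow> ('l \<Rightarrow> 'z \<Rightarrow> real) \<Rightarrow> real \<Rightarrow> real \<Rightarrow> 'l set \<Rightarrow> bool" where
  "location_privacy L N f \<epsilon> \<delta> S \<longleftrightarrow>
     (\<forall>p. adversary L \<delta> S p \<longrightarrow>
       (\<forall>z\<in>space N. evidence L f (cond_pmf p S) z > 0 \<longrightarrow>
         (\<forall>l\<in>L. (l \<notin> S \<longrightarrow> posterior L f (cond_pmf p S) z l = 0) \<and>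
                (l \<in> S \<longrightarrow> posterior L f (cond_pmf p S) z l \<le> inverse \<delta> * exp \<epsilon> * pmf p l))))"

end

theory Submission
  imports Defs
begin

text \<open>Conditioning on \<open>Lstar\<close>, of prior mass \<delta>, divides the prior by
  \<delta> inside and makes it zero outside. Bayes' rule keeps the zeros, and inside
  \<open>Lstar\<close> the LDP bound against the conditional prior becomes the claimed bound once
  that prior is written as \<open>pmf p l / \<delta>\<close>.\<close>

lemma pmf_cond_pmf_finite:
  assumes "finite S" and "0 < (\<Sum>l\<in>S. pmf p l)"
  shows "pmf (cond_pmf p S) l = (if l \<in> S then pmf p l / (\<Sum>l\<in>S. pmf p l) else 0)"
proof -
  \<comment> \<open>\<open>pmf_cond\<close> requires \<open>S\<close> to meet the support; positive
    mass provides a common point.\<close>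
  obtain x where "x \<in> S" "pmf p x \<noteq> 0"
    using assms(2) by (metis less_irrefl sum.neutral)
  then have "set_pmf p \<inter> S \<noteq> {}"
    by (auto simp: set_pmf_iff)
  then show ?thesis
    using assms(1) by (simp add: pmf_cond measure_measure_pmf_finite)
qed

theorem theorem5p4:
  fixes L Lstar :: "'l set" and N :: "'z measure" and f :: "'l \<Rightarrow> 'z \<Rightarrow> real"
    and \<epsilon> \<delta> :: real
  assumes "finite L"
    and "0 < \<delta>" and "\<delta> \<le> 1"
    and "0 < \<epsilon>"
    and "Lstar \<subseteq> L"
    and "mechanism L N f"
    and "LDP L N f \<epsilon> \<delta> Lstar"
  shows "location_privacy L N f \<epsilon> \<delta> Lstar"
proof -
  have "finite Lstar"
    using assms(1,5) by (rule rev_finite_subset)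
  \<comment> \<open>The normalizing mass is the same \<delta> for every adversary, which makes the
    factor in the final bound independent of \<open>p\<close>.\<close>
  have cond: "pmf (cond_pmf p Lstar) l = (if l \<in> Lstar then pmf p l / \<delta> else 0)"
    if "adversary L \<delta> Lstar p" for p l
    using that pmf_cond_pmf_finite[OF \<open>finite Lstar\<close>, of p l] assms(2)
    by (simp add: adversary_def obfuscation_set_def)
  show ?thesis
    using assms(7) unfolding LDP_def location_privacy_def
    by (fastforce simp: cond posterior_def field_simps)
qed

end
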